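(* Let $S$ be a subset of $\{A,B,C,D\}$ with $|S|=1$. A finite poset is an $S$-order if and only if it is a unit interval order.
   Context: Interval types: every interval $I_v$ considered has left endpoint $L(v)$, right endpoint $R(v)$ and center $c(v)=(L(v)+R(v))/2$, and is of one of four types: type $A$ (endpoints closed, center closed), type $B$ (endpoints open, center open), type $C$ (endpoints closed, center open), type $D$ (endpoints open, center closed). The words "open/closed" for the center are only labels; the center always belongs to the interval. Thus $L(v),R(v)$ are called open iff $I_v$ has type $B$ or $D$, and $c(v)$ is called open iff $I_v$ has type $B$ or $C$. For a nonempty $S\subseteq\{A,B,C,D\}$, an $S$-representation of a poset $(X,\prec)$ assigns to each $x\in X$ an interval $I_x$, all intervals having the same positive length, each of a type belonging to $S$, such that for all $x,y\in X$: $x\prec y$ if and only if (i) $R(x)<c(y)$, or (ii) $R(x)=c(y)$, at least one of $R(x),c(y)$ is open, and at least one of $L(y),c(x)$ is open. An $S$-order is a poset admitting an $S$-representation. A unit interval order is a poset $(X,\prec)$ for which each $x$ can be assigned a real interval $I_x$, all of the same length, with $x\prec y$ iff every point of $I_x$ is less than every point of $I_y$.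
   Formalization: In "unit interval order" the real intervals are taken to be closed and of equal positive length; if open and closed intervals of the same length could be mixed, the poset 3+1 would be represented by [-1,0], (0,1), [1,2], [0,1] and the claim would fail. *)

theory Defs
  imports Complex_Main
begin

definition finite_poset :: "'a set \<Rightarrow> ('a \<Rightarrow> 'a \<Rightarrow> bool) \<Rightarrow> bool" where
  "finite_poset X lt \<longleftrightarrow> finite X \<and> irreflp_on X lt \<and> transp_on X lt"

datatype interval_type = Type_A | Type_B | Type_C | Type_D

record typed_interval =
  left_end :: real
  right_end :: real
  kind :: interval_type

definition center :: "typed_interval \<Rightarrow> real" where
  "center J = (left_end J + right_end J) / 2"

definition open_ends :: "typed_interval \<Rightarrow> bool" where
  "open_ends J \<longleftrightarrow> kind J \<in> {Type_B, Type_D}"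

text \<open>Being an open center is only a label: the center belongs to the interval in all four types.\<close>

definition open_center :: "typed_interval \<Rightarrow> bool" where
  "open_center J \<longleftrightarrow> kind J \<in> {Type_B, Type_C}"

text \<open>In the last conjunct, the openness of the right endpoint of \<open>J\<close> is \<open>open_ends J\<close>
  and that of the left endpoint of \<open>K\<close> is \<open>open_ends K\<close>.\<close>

definition precedes :: "typed_interval \<Rightarrow> typed_interval \<Rightarrow> bool" where
  "precedes J K \<longleftrightarrow>
     right_end J < center K \<or>
     (right_end J = center K \<and> (open_ends J \<or> open_center K) \<and> (open_ends K \<or> open_center J))"

definition S_representation ::
  "interval_type set \<Rightarrow> 'a set \<Rightarrow> ('a \<Rightarrow> 'a \<Rightarrow> bool) \<Rightarrow> ('a \<Rightarrow> typed_interval) \<Rightarrow> bool" where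
  "S_representation S X lt I \<longleftrightarrow>
     (\<exists>len > 0. \<forall>x\<in>X. right_end (I x) - left_end (I x) = len) \<and>
     (\<forall>x\<in>X. kind (I x) \<in> S) \<and>
     (\<forall>x\<in>X. \<forall>y\<in>X. lt x y \<longleftrightarrow> precedes (I x) (I y))"

definition S_order :: "interval_type set \<Rightarrow> 'a set \<Rightarrow> ('a \<Rightarrow> 'a \<Rightarrow> bool) \<Rightarrow> bool" where
  "S_order S X lt \<longleftrightarrow>
     irreflp_on X lt \<and> transp_on X lt \<and> (\<exists>I. S_representation S X lt I)"

text \<open>The intervals are closed, as is standard for unit interval orders. If open and closed
  intervals could be mixed, the class would be strictly larger: the poset \<open>3 + 1\<close> would be
  represented by \<open>[-1,0]\<close>, \<open>(0,1)\<close>, \<open>[1,2]\<close> and \<open>[0,1]\<close>.\<close>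

definition unit_interval_order :: "'a set \<Rightarrow> ('a \<Rightarrow> 'a \<Rightarrow> bool) \<Rightarrow> bool" where
  "unit_interval_order X lt \<longleftrightarrow>
     irreflp_on X lt \<and> transp_on X lt \<and>
     (\<exists>(I :: 'a \<Rightarrow> real set) len. len > 0 \<and>
        (\<forall>x\<in>X. \<exists>l. I x = {l..l + len}) \<and>
        (\<forall>x\<in>X. \<forall>y\<in>X. lt x y \<longleftrightarrow> (\<forall>p\<in>I x. \<forall>q\<in>I y. p < q)))"

end

theory Submission
  imports Defs
begin

text \<open>If all intervals have length \<open>len\<close>, then \<open>precedes\<close> compares \<open>L(y) - L(x)\<close> with \<open>len / 2\<close>,
  strictly for type A and non-strictly for the other three types. A unit interval order with
  intervals of length \<open>len / 2\<close> uses the strict comparison. Since a finite poset gives rise to only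
  finitely many differences \<open>L(y) - L(x)\<close>, a strict threshold can be moved up, and a non-strict one
  down, to exchange the two kinds of comparison.\<close>

text \<open>The witness is the least element of \<open>D\<close> above \<open>a\<close>: no element
  of \<open>D\<close> lies strictly between the two thresholds.\<close>

lemma finite_less_to_le_threshold:
  fixes a :: real
  assumes "finite D" "a > 0"
  obtains b where "b > 0" "\<And>d. d \<in> D \<Longrightarrow> a < d \<longleftrightarrow> b \<le> d"
proof
  \<comment> \<open>The extra value \<open>a + 1\<close> keeps \<open>?E\<close> nonempty when no
    element of \<open>D\<close> exceeds \<open>a\<close>.\<close>
  let ?E = "insert (a + 1) {d \<in> D. a < d}"
  have fin: "finite ?E" using assms by simp
  have gt: "a < Min ?E" using fin by (subst Min_gr_iff) auto
  show "Min ?E > 0" using gt assms by linarith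
  show "a < d \<longleftrightarrow> Min ?E \<le> d" if "d \<in> D" for d
    using that gt Min_le[OF fin, of d] by auto
qed

text \<open>Dually, the witness is the greatest element of \<open>D\<close> below \<open>a\<close>,
  unless that falls under \<open>a / 2\<close>.\<close>

lemma finite_le_to_less_threshold:
  fixes a :: real
  assumes "finite D" "a > 0"
  obtains b where "b > 0" "\<And>d. d \<in> D \<Longrightarrow> a \<le> d \<longleftrightarrow> b < d"
proof
  \<comment> \<open>Inserting \<open>a / 2\<close> makes \<open>?E\<close> nonempty and also forces
    its maximum to be positive.\<close>
  let ?E = "insert (a / 2) {d \<in> D. d < a}"
  have fin: "finite ?E" using assms by simp
  have lt: "Max ?E < a" using fin assms by (subst Max_less_iff) auto
  have "a / 2 \<le> Max ?E" using fin by (intro Max_ge) auto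
  then show "Max ?E > 0" using assms by linarith
  show "a \<le> d \<longleftrightarrow> Max ?E < d" if "d \<in> D" for d
    using that lt Max_ge[OF fin, of d] by (cases "d < a") auto
qed

text \<open>The same \<open>f\<close> serves on both sides; only the threshold moves, within a gap
  of the finite set \<open>D f\<close> of differences.\<close>

lemma threshold_less_iff_le:
  fixes X :: "'a set"
  assumes "finite X"
  shows "(\<exists>(f :: 'a \<Rightarrow> real) a. a > 0 \<and> (\<forall>x\<in>X. \<forall>y\<in>X. lt x y \<longleftrightarrow> a < f y - f x)) \<longleftrightarrow>
         (\<exists>(f :: 'a \<Rightarrow> real) a. a > 0 \<and> (\<forall>x\<in>X. \<forall>y\<in>X. lt x y \<longleftrightarrow> a \<le> f y - f x))"
    (is "?L \<longleftrightarrow> ?R")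
proof -
  define D where "D f = (\<lambda>(x, y). f y - f x) ` (X \<times> X)" for f :: "'a \<Rightarrow> real"
  have fin: "finite (D f)" for f
    using assms by (simp add: D_def)
  have mem: "f y - f x \<in> D f" if "x \<in> X" "y \<in> X" for f x y
    using that by (force simp: D_def)
  show ?thesis
  proof
    assume ?L
    then obtain f :: "'a \<Rightarrow> real" and a where a: "a > 0"
      and f: "\<forall>x\<in>X. \<forall>y\<in>X. lt x y \<longleftrightarrow> a < f y - f x"
      by blast
    obtain b where "b > 0" "\<And>d. d \<in> D f \<Longrightarrow> a < d \<longleftrightarrow> b \<le> d"
      using finite_less_to_le_threshold[OF fin[of f] a] by blast
    with f mem show ?R by (intro exI[of _ f] exI[of _ b]) auto
  next
    assume ?R
    then obtain f :: "'a \<Rightarrow> real" and a where a: "a > 0"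
      and f: "\<forall>x\<in>X. \<forall>y\<in>X. lt x y \<longleftrightarrow> a \<le> f y - f x"
      by blast
    obtain b where "b > 0" "\<And>d. d \<in> D f \<Longrightarrow> a \<le> d \<longleftrightarrow> b < d"
      using finite_le_to_less_threshold[OF fin[of f] a] by blast
    with f mem show ?L by (intro exI[of _ f] exI[of _ b]) auto
  qed
qed

text \<open>The closest pair decides: the right end \<open>l + a\<close> of the first interval
  against the left end \<open>m\<close> of the second, both of which are attained.\<close>

lemma closed_interval_less_iff:
  fixes l m a :: real
  assumes "a > 0"
  shows "(\<forall>p\<in>{l..l + a}. \<forall>q\<in>{m..m + a}. p < q) \<longleftrightarrow> a < m - l"
  using assms by (fastforce dest: bspec[of _ _ "l + a"] bspec[of _ _ m])

text \<open>Here \<open>f\<close> gives the left endpoints and \<open>a\<close> is the common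
  length.\<close>

lemma unit_interval_order_iff_threshold:
  fixes X :: "'a set"
  shows "unit_interval_order X lt \<longleftrightarrow> irreflp_on X lt \<and> transp_on X lt \<and>
     (\<exists>(f :: 'a \<Rightarrow> real) a. a > 0 \<and> (\<forall>x\<in>X. \<forall>y\<in>X. lt x y \<longleftrightarrow> a < f y - f x))"
proof -
  have "(\<exists>(I :: 'a \<Rightarrow> real set) len. len > 0 \<and> (\<forall>x\<in>X. \<exists>l. I x = {l..l + len}) \<and>
          (\<forall>x\<in>X. \<forall>y\<in>X. lt x y \<longleftrightarrow> (\<forall>p\<in>I x. \<forall>q\<in>I y. p < q))) \<longleftrightarrow>
        (\<exists>(f :: 'a \<Rightarrow> real) a. a > 0 \<and> (\<forall>x\<in>X. \<forall>y\<in>X. lt x y \<longleftrightarrow> a < f y - f x))"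
    (is "?L \<longleftrightarrow> ?R")
  proof
    assume ?L
    then obtain I :: "'a \<Rightarrow> real set" and len where len: "len > 0"
      and I: "\<forall>x\<in>X. \<exists>l. I x = {l..l + len}"
      and lt: "\<forall>x\<in>X. \<forall>y\<in>X. lt x y \<longleftrightarrow> (\<forall>p\<in>I x. \<forall>q\<in>I y. p < q)"
      by blast
    from I obtain f where f: "\<forall>x\<in>X. I x = {f x..f x + len}"
      by metis
    have "lt x y \<longleftrightarrow> len < f y - f x" if "x \<in> X" "y \<in> X" for x y
      using lt f that closed_interval_less_iff[OF len, of "f x" "f y"] by simp
    with len show ?R by blast
  next
    assume ?R
    then obtain f :: "'a \<Rightarrow> real" and a where a: "a > 0"
      and f: "\<forall>x\<in>X. \<forall>y\<in>X. lt x y \<longleftrightarrow> a < f y - f x"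
      by blast
    show ?L
      by (rule exI[of _ "\<lambda>x. {f x..f x + a}"], rule exI[of _ a])
        (use a f closed_interval_less_iff[OF a] in auto)
  qed
  then show ?thesis by (simp add: unit_interval_order_def)
qed

text \<open>The center of \<open>K\<close> lies \<open>len / 2\<close> to the right of its left end,
  so the right end of \<open>J\<close> is before it exactly when the left ends differ by more than
  \<open>len / 2\<close>.\<close>

lemma precedes_same_kind_iff:
  assumes "right_end J - left_end J = len" "right_end K - left_end K = len" "kind J = kind K"
  shows "precedes J K \<longleftrightarrow>
    (if kind K = Type_A then len / 2 < left_end K - left_end J
     else len / 2 \<le> left_end K - left_end J)"
proof -
  have c: "center K = left_end K + len / 2" and r: "right_end J = left_end J + len"
    using assms by (auto simp: center_def)
  show ?thesis
    using assms(3) unfolding precedes_def c r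
    \<comment> \<open>In the tie case, type A has nothing open, so both conjuncts fail; for B and D
      the open ends, and for C the open centers, satisfy both.\<close>
    by (cases "kind K") (auto simp: open_ends_def open_center_def)
qed

lemma S_order_singleton_iff_threshold:
  fixes X :: "'a set"
  shows "S_order {k} X lt \<longleftrightarrow> irreflp_on X lt \<and> transp_on X lt \<and>
     (\<exists>(f :: 'a \<Rightarrow> real) a. a > 0 \<and>
        (\<forall>x\<in>X. \<forall>y\<in>X. lt x y \<longleftrightarrow> (if k = Type_A then a < f y - f x else a \<le> f y - f x)))"
proof -
  have "(\<exists>I. S_representation {k} X lt I) \<longleftrightarrow>
    (\<exists>(f :: 'a \<Rightarrow> real) a. a > 0 \<and>
        (\<forall>x\<in>X. \<forall>y\<in>X. lt x y \<longleftrightarrow> (if k = Type_A then a < f y - f x else a \<le> f y - f x)))"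
    (is "?L \<longleftrightarrow> ?R")
  proof
    assume ?L
    then obtain I len where len: "len > 0" "\<forall>x\<in>X. right_end (I x) - left_end (I x) = len"
      and k: "\<forall>x\<in>X. kind (I x) = k"
      and lt: "\<forall>x\<in>X. \<forall>y\<in>X. lt x y \<longleftrightarrow> precedes (I x) (I y)"
      unfolding S_representation_def by auto
    show ?R
      by (rule exI[of _ "\<lambda>x. left_end (I x)"], rule exI[of _ "len / 2"])
        (use len k lt precedes_same_kind_iff[of _ len] in simp)
  next
    assume ?R
    then obtain f :: "'a \<Rightarrow> real" and a where a: "a > 0"
      and f: "\<forall>x\<in>X. \<forall>y\<in>X. lt x y \<longleftrightarrow> (if k = Type_A then a < f y - f x else a \<le> f y - f x)"
      by blast
    \<comment> \<open>Length \<open>2 * a\<close> makes the half-length that \<open>precedes\<close>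
      compares with equal to \<open>a\<close>.\<close>
    define I where "I x = \<lparr>left_end = f x, right_end = f x + 2 * a, kind = k\<rparr>" for x
    have "S_representation {k} X lt I"
      unfolding S_representation_def
      using a f precedes_same_kind_iff[of _ "2 * a"]
      by (auto simp: I_def intro!: exI[of _ "2 * a"])
    then show ?L by blast
  qed
  then show ?thesis by (simp add: S_order_def)
qed

theorem theorem2:
  fixes S :: "interval_type set" and X :: "'a set" and lt :: "'a \<Rightarrow> 'a \<Rightarrow> bool"
  assumes "card S = 1"
    and "finite_poset X lt"
  shows "S_order S X lt \<longleftrightarrow> unit_interval_order X lt"
proof -
  obtain k where k: "S = {k}"
    using assms(1) card_1_singletonE by blast
  have "finite X" using assms(2) by (simp add: finite_poset_def)
  \<comment> \<open>For \<open>Type_A\<close> the two threshold conditions coincide; the other types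
    need the exchange of \<open><\<close> and \<open>\<le>\<close>, hence finiteness.\<close>
  from threshold_less_iff_le[OF this, of lt] show ?thesis
    unfolding k S_order_singleton_iff_threshold unit_interval_order_iff_threshold
    by (cases "k = Type_A") simp_all
qed

end
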